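(* Let $G$ be a connected Lie group with Lie algebra $\mathfrak{g}$ endowed with a left-invariant (sub-)Lorentzian structure given by $(\mathfrak{p},\langle\cdot,\cdot\rangle,e_0)$ and an orthonormal basis $e_0,\dots,e_n$ of $\mathfrak{g}$ such that $e_0,\dots,e_r$ is a basis of $\mathfrak{p}$. Then any normal isotropic extremal $g=g(t)$ of the corresponding left-invariant (sub-)Lorentzian (anti)metric on $G$ is a solution (together with a covector function with components $\psi_j=\psi_j(t)$, $j=0,\dots,n$) of the system of differential equations $$g'(t)=dl_{g(t)}(u(t)),\quad u(t)=\psi_0(t)e_0-\sum_{i=1}^{r}\psi_i(t)e_i,\quad \|u(0)\|=0,\quad \psi_0(t)\equiv 1,$$ $$\psi_j'(t)=\sum_{k=0}^{n}\left(C_{0j}^{k}\psi_0\psi_k-\sum_{i=1}^{r}C_{ij}^{k}\psi_i\psi_k\right),\quad j=1,\dots,n,$$ where $C_{ij}^k$ are the structure constants of $\mathfrak{g}$ in the basis $e_0,\dots,e_n$, i.e. $[e_i,e_j]=\sum_{k=0}^n C_{ij}^k e_k$.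
   Context: Setting: $G$ is a connected Lie group with Lie algebra $(\mathfrak{g},[\cdot,\cdot])$; $\mathfrak{p}\subset\mathfrak{g}$ is a subspace generating $\mathfrak{g}$ by the bracket; $\langle\cdot,\cdot\rangle$ is a pseudoscalar product of signature $(+,-,\dots,-)$ on $\mathfrak{g}$; $e_0,\dots,e_n$ is an orthonormal basis of $\mathfrak{g}$ ($\langle e_0,e_0\rangle=1$, $\langle e_i,e_i\rangle=-1$ for $i\ge 1$, $\langle e_i,e_j\rangle=0$ for $i\ne j$) such that $e_0,\dots,e_r$ is a basis of $\mathfrak{p}$; $e_0$ gives the time orientation. $l_g$ is the left shift $h\mapsto gh$, $dl_g$ its differential, $\|u\|=\sqrt{\langle u,u\rangle}$ when $\langle u,u\rangle\ge0$. A horizontal curve is a Lipschitzian curve with $g'(t)=dl_{g(t)}(u(t))$, $u(t)\in\mathfrak{p}$ for almost all $t$; it is isotropic if $\langle u(t),u(t)\rangle=0$, $u(t)\neq 0$ a.e., and future directed if $\langle u(t),e_0\rangle>0$ a.e. Identify $\mathfrak{g}^*$ with $\mathfrak{g}$ via $\langle\cdot,\cdot\rangle$, and write $\psi_j=\psi(e_j)$, so that $\psi=\psi_0e_0-\sum_{i=1}^n\psi_ie_i$. Put $W=\{w\in\mathfrak{p}\mid \langle w,e_0\rangle=0,\ \langle w,w\rangle=-1\}$. A normal isotropic extremal is a future directed isotropic horizontal curve $g(t)$, $t\in\mathbb{R}$, whose control is normalized as $u(t)=e_0+w(t)$ (that is, $u_0\equiv1$), for which there exists an absolutely continuous function $\psi(t)\in\mathfrak{g}^*$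 with $\psi_0(t)\equiv 1$ such that for almost all $t$: $\frac{d}{dt}\psi(t)(v)=\psi(t)([u(t),v])$ for all $v\in\mathfrak{g}$, and $\langle\psi(t),w(t)\rangle=\min_{w\in W}\langle\psi(t),w\rangle=-1$, where $w(t)=u(t)-e_0\in W$. *)

theory Defs
  imports "HOL-Analysis.Analysis" "HOL-Algebra.Group" "HOL-Library.Function_Algebras"
begin

section \<open>Pointwise real vector space structure on functions\<close>

instantiation "fun" :: (type, real_vector) real_vector
begin

definition scaleR_fun :: "real \<Rightarrow> ('a \<Rightarrow> 'b) \<Rightarrow> 'a \<Rightarrow> 'b"
  where "scaleR_fun c f = (\<lambda>x. c *\<^sub>R f x)"

instance
  by standard (auto simp: scaleR_fun_def fun_eq_iff algebra_simps)

end

lemma scaleR_fun_apply [simp]: "(c *\<^sub>R f) x = c *\<^sub>R f x"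
  by (simp add: scaleR_fun_def)


section \<open>Smooth manifolds and Lie groups\<close>

text \<open>\<^term>\<open>S\<close> is meant to be open; all partial derivatives up to order \<^term>\<open>k\<close>
  exist and are continuous on \<^term>\<open>S\<close>.\<close>

primrec Ck_on :: "nat \<Rightarrow> 'a::euclidean_space set \<Rightarrow> ('a \<Rightarrow> 'b::real_normed_vector) \<Rightarrow> bool"
  where
    "Ck_on 0 S f \<longleftrightarrow> continuous_on S f"
  | "Ck_on (Suc k) S f \<longleftrightarrow> (\<forall>x\<in>S. f differentiable (at x)) \<and>
       (\<forall>v. Ck_on k S (\<lambda>x. frechet_derivative f (at x) v))"

definition smooth_on :: "'a::euclidean_space set \<Rightarrow> ('a \<Rightarrow> 'b::real_normed_vector) \<Rightarrow> bool"
  where "smooth_on S f \<longleftrightarrow> (\<forall>k. Ck_on k S f)"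

type_synonym ('a, 'e) atlas = "('a set \<times> ('a \<Rightarrow> 'e)) set"

definition is_chart :: "'a::topological_space set \<Rightarrow> ('a \<Rightarrow> 'e::euclidean_space) \<Rightarrow> bool"
  where "is_chart U \<phi> \<longleftrightarrow>
    open U \<and> open (\<phi> ` U) \<and> homeomorphism U (\<phi> ` U) \<phi> (inv_into U \<phi>)"

definition smooth_manifold ::
  "('a::{t2_space, second_countable_topology}, 'e::euclidean_space) atlas \<Rightarrow> bool"
  where "smooth_manifold A \<longleftrightarrow>
    (\<forall>(U, \<phi>)\<in>A. is_chart U \<phi>) \<and> (\<Union>(U, \<phi>)\<in>A. U) = UNIV \<and>
    (\<forall>(U, \<phi>)\<in>A. \<forall>(V, \<theta>)\<in>A. smooth_on (\<phi> ` (U \<inter> V)) (\<theta> \<circ> inv_into U \<phi>))"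

definition smooth_map ::
  "('a::topological_space, 'e::euclidean_space) atlas \<Rightarrow>
   ('b::topological_space, 'f::euclidean_space) atlas \<Rightarrow> ('a \<Rightarrow> 'b) \<Rightarrow> bool"
  where "smooth_map A B F \<longleftrightarrow> continuous_on UNIV F \<and>
    (\<forall>(U, \<phi>)\<in>A. \<forall>(V, \<theta>)\<in>B. smooth_on (\<phi> ` (U \<inter> F -` V)) (\<theta> \<circ> F \<circ> inv_into U \<phi>))"

definition prod_atlas :: "('a, 'e) atlas \<Rightarrow> ('b, 'f) atlas \<Rightarrow> ('a \<times> 'b, 'e \<times> 'f) atlas"
  where "prod_atlas A B =
    {(U \<times> V, map_prod \<phi> \<theta>) | U \<phi> V \<theta>. (U, \<phi>) \<in> A \<and> (V, \<theta>) \<in> B}"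

record ('a, 'e) smooth_group = "'a monoid" +
  atlas :: "('a, 'e) atlas"

definition lie_group ::
  "('a::{t2_space, second_countable_topology}, 'e::euclidean_space) smooth_group \<Rightarrow> bool"
  where "lie_group G \<longleftrightarrow>
    group G \<and> carrier G = UNIV \<and> smooth_manifold (atlas G) \<and>
    smooth_map (prod_atlas (atlas G) (atlas G)) (atlas G) (\<lambda>(x, y). x \<otimes>\<^bsub>G\<^esub> y) \<and>
    smooth_map (atlas G) (atlas G) (\<lambda>x. inv\<^bsub>G\<^esub> x)"

definition smooth_funs ::
  "('a::topological_space, 'e::euclidean_space) smooth_group \<Rightarrow> ('a \<Rightarrow> real) set"
  where "smooth_funs G = {f. smooth_map (atlas G) {(UNIV, id)} f}"


section \<open>Tangent vectors and the Lie algebra\<close>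

text \<open>Tangent vectors at \<^term>\<open>p\<close> are the derivations at \<^term>\<open>p\<close> of the algebra of smooth
  functions. They are set to zero off the smooth functions, so that equality of tangent vectors
  is equality of functions; the same convention is used in the differential and the bracket.\<close>

type_synonym 'a tangent = "('a \<Rightarrow> real) \<Rightarrow> real"
type_synonym 'a vfield = "'a \<Rightarrow> 'a tangent"

definition tangent_space ::
  "('a::topological_space, 'e::euclidean_space) smooth_group \<Rightarrow> 'a \<Rightarrow> 'a tangent set"
  where "tangent_space G p = {v.
    (\<forall>f\<in>smooth_funs G. \<forall>h\<in>smooth_funs G. v (f + h) = v f + v h) \<and>
    (\<forall>f\<in>smooth_funs G. \<forall>c. v (c *\<^sub>R f) = c * v f) \<and>
    (\<forall>f\<in>smooth_funs G. \<forall>h\<in>smooth_funs G. v (f * h) = f p * v h + h p * v f) \<and>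
    (\<forall>f. f \<notin> smooth_funs G \<longrightarrow> v f = 0)}"

definition differential ::
  "('a::topological_space, 'e::euclidean_space) smooth_group \<Rightarrow>
   ('a \<Rightarrow> 'a) \<Rightarrow> 'a tangent \<Rightarrow> 'a tangent"
  where "differential G F v = (\<lambda>f. if f \<in> smooth_funs G then v (f \<circ> F) else 0)"

definition left_shift :: "('a, 'e) smooth_group \<Rightarrow> 'a \<Rightarrow> 'a \<Rightarrow> 'a"
  where "left_shift G a = (\<lambda>h. a \<otimes>\<^bsub>G\<^esub> h)"

text \<open>The Lie algebra consists of the left-invariant smooth vector fields; the element
  \<^term>\<open>X\<close> corresponds to the tangent vector \<^term>\<open>X \<one>\<^bsub>G\<^esub>\<close> at the identity.\<close>

definition lie_algebra ::
  "('a::topological_space, 'e::euclidean_space) smooth_group \<Rightarrow> 'a vfield set"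
  where "lie_algebra G = {X.
    (\<forall>p. X p \<in> tangent_space G p) \<and>
    (\<forall>f\<in>smooth_funs G. (\<lambda>p. X p f) \<in> smooth_funs G) \<and>
    (\<forall>a p. differential G (left_shift G a) (X p) = X (left_shift G a p))}"

definition bracket ::
  "('a::topological_space, 'e::euclidean_space) smooth_group \<Rightarrow>
   'a vfield \<Rightarrow> 'a vfield \<Rightarrow> 'a vfield"
  where "bracket G X Y = (\<lambda>p f.
    if f \<in> smooth_funs G then X p (\<lambda>q. Y q f) - Y p (\<lambda>q. X q f) else 0)"

definition dl ::
  "('a::topological_space, 'e::euclidean_space) smooth_group \<Rightarrow> 'a \<Rightarrow> 'a vfield \<Rightarrow> 'a tangent"
  where "dl G a X = differential G (left_shift G a) (X \<one>\<^bsub>G\<^esub>)"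

definition lie_generates ::
  "('a::topological_space, 'e::euclidean_space) smooth_group \<Rightarrow> 'a vfield set \<Rightarrow> bool"
  where "lie_generates G \<pp> \<longleftrightarrow>
    (\<lambda>S. subspace S \<and> (\<forall>X\<in>S. \<forall>Y\<in>S. bracket G X Y \<in> S)) hull \<pp> = lie_algebra G"

definition lie_dual ::
  "('a::topological_space, 'e::euclidean_space) smooth_group \<Rightarrow> ('a vfield \<Rightarrow> real) set"
  where "lie_dual G = {\<psi>.
    (\<forall>X\<in>lie_algebra G. \<forall>Y\<in>lie_algebra G. \<psi> (X + Y) = \<psi> X + \<psi> Y) \<and>
    (\<forall>X\<in>lie_algebra G. \<forall>c. \<psi> (c *\<^sub>R X) = c * \<psi> X)}"


section \<open>Left-invariant (sub-)Lorentzian structures\<close>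

definition symmetric_bilinear_form ::
  "('a::topological_space, 'e::euclidean_space) smooth_group \<Rightarrow>
   ('a vfield \<Rightarrow> 'a vfield \<Rightarrow> real) \<Rightarrow> bool"
  where "symmetric_bilinear_form G B \<longleftrightarrow>
    (\<forall>X\<in>lie_algebra G. B X \<in> lie_dual G) \<and>
    (\<forall>X\<in>lie_algebra G. \<forall>Y\<in>lie_algebra G. B X Y = B Y X)"

text \<open>The existence of the orthonormal basis says that the form \<^term>\<open>B\<close> is nondegenerate of
  signature \<open>(+,-,\<dots>,-)\<close>. The vectors \<^term>\<open>e 0\<close>, ..., \<^term>\<open>e n\<close> are distinct by
  orthonormality.\<close>

definition sub_lorentzian ::
  "('a::{t2_space, second_countable_topology}, 'e::euclidean_space) smooth_group \<Rightarrow>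
   'a vfield set \<Rightarrow> ('a vfield \<Rightarrow> 'a vfield \<Rightarrow> real) \<Rightarrow> nat \<Rightarrow> nat \<Rightarrow> (nat \<Rightarrow> 'a vfield) \<Rightarrow> bool"
  where "sub_lorentzian G \<pp> B n r e \<longleftrightarrow>
    lie_group G \<and> connected (UNIV :: 'a set) \<and>
    \<pp> \<subseteq> lie_algebra G \<and> subspace \<pp> \<and> lie_generates G \<pp> \<and>
    symmetric_bilinear_form G B \<and>
    independent (e ` {0..n}) \<and> span (e ` {0..n}) = lie_algebra G \<and>
    (\<forall>i\<le>n. \<forall>j\<le>n. B (e i) (e j) = (if i \<noteq> j then 0 else if i = 0 then 1 else - 1)) \<and>
    r \<le> n \<and> span (e ` {0..r}) = \<pp>"

definition pseudo_norm :: "('a vfield \<Rightarrow> 'a vfield \<Rightarrow> real) \<Rightarrow> 'a vfield \<Rightarrow> real"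
  where "pseudo_norm B X = sqrt (B X X)"

text \<open>The identification of covectors with elements of the Lie algebra by means of \<^term>\<open>B\<close>.\<close>

definition covector_to_vector ::
  "('a::topological_space, 'e::euclidean_space) smooth_group \<Rightarrow>
   ('a vfield \<Rightarrow> 'a vfield \<Rightarrow> real) \<Rightarrow> ('a vfield \<Rightarrow> real) \<Rightarrow> 'a vfield"
  where "covector_to_vector G B \<psi> =
    (THE X. X \<in> lie_algebra G \<and> (\<forall>Y\<in>lie_algebra G. B X Y = \<psi> Y))"


section \<open>Horizontal curves and normal isotropic extremals\<close>

definition lipschitz_curve ::
  "('a::topological_space, 'e::euclidean_space) smooth_group \<Rightarrow> (real \<Rightarrow> 'a) \<Rightarrow> bool"
  where "lipschitz_curve G g \<longleftrightarrow>
    (\<forall>t. \<forall>(U, \<phi>)\<in>atlas G. g t \<in> U \<longrightarrow>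
      (\<exists>d>0. \<exists>L. g ` ball t d \<subseteq> U \<and> L-lipschitz_on (ball t d) (\<phi> \<circ> g)))"

definition has_velocity ::
  "('a::topological_space, 'e::euclidean_space) smooth_group \<Rightarrow>
   (real \<Rightarrow> 'a) \<Rightarrow> 'a tangent \<Rightarrow> real \<Rightarrow> bool"
  where "has_velocity G g v t \<longleftrightarrow>
    v \<in> tangent_space G (g t) \<and>
    (\<forall>f\<in>smooth_funs G. ((\<lambda>s. f (g s)) has_real_derivative v f) (at t))"

definition horizontal_curve ::
  "('a::topological_space, 'e::euclidean_space) smooth_group \<Rightarrow> 'a vfield set \<Rightarrow>
   (real \<Rightarrow> 'a) \<Rightarrow> (real \<Rightarrow> 'a vfield) \<Rightarrow> bool"
  where "horizontal_curve G \<pp> g u \<longleftrightarrow> lipschitz_curve G g \<and>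
    (AE t in lebesgue. u t \<in> \<pp> \<and> has_velocity G g (dl G (g t) (u t)) t)"

definition isotropic :: "('a vfield \<Rightarrow> 'a vfield \<Rightarrow> real) \<Rightarrow> (real \<Rightarrow> 'a vfield) \<Rightarrow> bool"
  where "isotropic B u \<longleftrightarrow> (AE t in lebesgue. B (u t) (u t) = 0 \<and> u t \<noteq> 0)"

definition future_directed ::
  "('a vfield \<Rightarrow> 'a vfield \<Rightarrow> real) \<Rightarrow> 'a vfield \<Rightarrow> (real \<Rightarrow> 'a vfield) \<Rightarrow> bool"
  where "future_directed B e0 u \<longleftrightarrow> (AE t in lebesgue. B (u t) e0 > 0)"

definition unit_space_vectors ::
  "'a vfield set \<Rightarrow> ('a vfield \<Rightarrow> 'a vfield \<Rightarrow> real) \<Rightarrow> 'a vfield \<Rightarrow> 'a vfield set"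
  where "unit_space_vectors \<pp> B e0 = {w\<in>\<pp>. B w e0 = 0 \<and> B w w = - 1}"

definition abs_continuous_on :: "real set \<Rightarrow> (real \<Rightarrow> 'b::real_normed_vector) \<Rightarrow> bool"
  where "abs_continuous_on S f \<longleftrightarrow>
    (\<forall>\<epsilon>>0. \<exists>\<delta>>0. \<forall>D. D division_of (\<Union>D) \<and> \<Union>D \<subseteq> S \<and> (\<Sum>K\<in>D. Sup K - Inf K) < \<delta> \<longrightarrow>
      (\<Sum>K\<in>D. norm (f (Sup K) - f (Inf K))) < \<epsilon>)"

text \<open>\<^term>\<open>\<psi>\<close> is a covector function witnessing that the curve \<^term>\<open>g\<close> is a normal isotropic
  extremal. The control \<^term>\<open>u\<close> only matters up to null sets, so its normalization
  \<open>u = e0 + w\<close> with \<open>w\<close> in \<^term>\<open>unit_space_vectors \<pp> B e0\<close> is required almost everywhere;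
  it is contained in the minimum condition on \<^term>\<open>u t - e0\<close>.\<close>

definition normal_isotropic_extremal_with ::
  "('a::topological_space, 'e::euclidean_space) smooth_group \<Rightarrow> 'a vfield set \<Rightarrow>
   ('a vfield \<Rightarrow> 'a vfield \<Rightarrow> real) \<Rightarrow> 'a vfield \<Rightarrow> (real \<Rightarrow> 'a) \<Rightarrow>
   (real \<Rightarrow> 'a vfield \<Rightarrow> real) \<Rightarrow> bool"
  where "normal_isotropic_extremal_with G \<pp> B e0 g \<psi> \<longleftrightarrow>
    (\<forall>t. \<psi> t \<in> lie_dual G) \<and>
    (\<forall>v\<in>lie_algebra G. \<forall>a b. abs_continuous_on {a..b} (\<lambda>t. \<psi> t v)) \<and>
    (\<forall>t. \<psi> t e0 = 1) \<and>
    (\<exists>u. horizontal_curve G \<pp> g u \<and> isotropic B u \<and> future_directed B e0 u \<and>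
      (AE t in lebesgue. \<forall>v\<in>lie_algebra G.
        ((\<lambda>s. \<psi> s v) has_real_derivative \<psi> t (bracket G (u t) v)) (at t)) \<and>
      (AE t in lebesgue.
        is_arg_min (B (covector_to_vector G B (\<psi> t)))
          (\<lambda>w. w \<in> unit_space_vectors \<pp> B e0) (u t - e0) \<and>
        B (covector_to_vector G B (\<psi> t)) (u t - e0) = - 1))"

definition normal_isotropic_extremal ::
  "('a::topological_space, 'e::euclidean_space) smooth_group \<Rightarrow> 'a vfield set \<Rightarrow>
   ('a vfield \<Rightarrow> 'a vfield \<Rightarrow> real) \<Rightarrow> 'a vfield \<Rightarrow> (real \<Rightarrow> 'a) \<Rightarrow> bool"
  where "normal_isotropic_extremal G \<pp> B e0 g \<longleftrightarrow>
    (\<exists>\<psi>. normal_isotropic_extremal_with G \<pp> B e0 g \<psi>)"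

end

theory Submission
  imports Defs
begin

text \<open>On the admissible controls \<open>e 0 + w\<close>, where \<open>w\<close> runs through the unit sphere of the spacelike
  horizontal directions, the minimum condition is a Euclidean problem: a linear functional with
  components \<open>\<psi> (e 1), \<dots>, \<psi> (e r)\<close> is minimized on the unit sphere, and the minimum is
  required to be \<open>- 1\<close>. Hence the components form a unit vector and the unique minimizer is its
  opposite (\<open>minimizer_eq_control\<close>). So the control equals
  \<open>\<psi> (e 0) e 0 - \<Sum> \<psi> (e i) e i\<close> for almost every time, and expanding the adjoint equation in the
  frame gives the system with the structure constants (\<open>bracket_control\<close>).

  All this holds almost everywhere only, whereas the differential equations are asserted at
  every time. The covector is absolutely continuous, so the right-hand side of the adjoint equation
  is continuous once the control is expressed by the covector; by the fundamental theorem of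
  calculus for absolutely continuous functions the covector is then an integral of a continuous
  function, hence differentiable everywhere (\<open>has_vector_derivative_abs_continuous_AE\<close>). The curve is
  treated in the same way: a smooth function along a curve that is Lipschitz in charts is locally
  Lipschitz, hence absolutely continuous
  (\<open>has_real_derivative_smooth_fun_along_lipschitz_curve\<close>). Finally, the length of the restricted
  covector is continuous and equal to one almost everywhere, so that the control is isotropic at
  every time, in particular at time zero.\<close>

section \<open>Absolutely continuous functions\<close>

lemma abs_continuous_on_subset:
  assumes "abs_continuous_on S f" "T \<subseteq> S"
  shows "abs_continuous_on T f"
  unfolding abs_continuous_on_def
proof (intro allI impI)
  fix \<epsilon> :: real assume "\<epsilon> > 0"
  obtain \<delta> where "\<delta> > 0" and \<delta>: "\<forall>D. D division_of (\<Union>D) \<and> \<Union>D \<subseteq> S \<and>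
    (\<Sum>K\<in>D. Sup K - Inf K) < \<delta> \<longrightarrow> (\<Sum>K\<in>D. norm (f (Sup K) - f (Inf K))) < \<epsilon>"
    using assms(1)[unfolded abs_continuous_on_def] \<open>\<epsilon> > 0\<close> by blast
  then show "\<exists>\<delta>>0. \<forall>D. D division_of (\<Union>D) \<and> \<Union>D \<subseteq> T \<and> (\<Sum>K\<in>D. Sup K - Inf K) < \<delta>
      \<longrightarrow> (\<Sum>K\<in>D. norm (f (Sup K) - f (Inf K))) < \<epsilon>"
    using assms(2) by (meson order_trans)
qed

lemma abs_continuous_on_imp_continuous_on:
  fixes f :: "real \<Rightarrow> 'b::real_normed_vector"
  assumes "abs_continuous_on {a..b} f"
  shows "continuous_on {a..b} f"
  unfolding continuous_on_iff
proof (intro ballI allI impI)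
  fix x \<epsilon> :: real assume x: "x \<in> {a..b}" and "\<epsilon> > 0"
  obtain \<delta> where "\<delta> > 0" and \<delta>: "\<forall>D. D division_of (\<Union>D) \<and> \<Union>D \<subseteq> {a..b} \<and>
    (\<Sum>K\<in>D. Sup K - Inf K) < \<delta> \<longrightarrow> (\<Sum>K\<in>D. norm (f (Sup K) - f (Inf K))) < \<epsilon>"
    using assms[unfolded abs_continuous_on_def] \<open>\<epsilon> > 0\<close> by blast
  have close: "norm (f v - f u) < \<epsilon>" if "a \<le> u" "u \<le> v" "v \<le> b" "v - u < \<delta>" for u v
    using \<delta>[rule_format, of "{{u..v}}"] that division_of_self[of u v] by simp
  show "\<exists>d>0. \<forall>x'\<in>{a..b}. dist x' x < d \<longrightarrow> dist (f x') (f x) < \<epsilon>"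
  proof (intro exI[of _ \<delta>] conjI ballI impI \<open>\<delta> > 0\<close>)
    fix y assume "y \<in> {a..b}" "dist y x < \<delta>"
    then show "dist (f y) (f x) < \<epsilon>"
      using close[of x y] close[of y x] x
      by (cases "x \<le> y") (auto simp: dist_norm norm_minus_commute)
  qed
qed

lemma lipschitz_on_imp_abs_continuous_on:
  fixes f :: "real \<Rightarrow> 'b::real_normed_vector"
  assumes "L-lipschitz_on S f"
  shows "abs_continuous_on S f"
  unfolding abs_continuous_on_def
proof (intro allI impI)
  fix \<epsilon> :: real assume "\<epsilon> > 0"
  have "L \<ge> 0" using assms by (rule lipschitz_on_nonneg)
  show "\<exists>\<delta>>0. \<forall>D. D division_of (\<Union>D) \<and> \<Union>D \<subseteq> S \<and> (\<Sum>K\<in>D. Sup K - Inf K) < \<delta>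
      \<longrightarrow> (\<Sum>K\<in>D. norm (f (Sup K) - f (Inf K))) < \<epsilon>"
  proof (intro exI[of _ "\<epsilon> / (L + 1)"] conjI allI impI)
    show "\<epsilon> / (L + 1) > 0" using \<open>\<epsilon> > 0\<close> \<open>L \<ge> 0\<close> by simp
    fix D assume D: "D division_of (\<Union>D) \<and> \<Union>D \<subseteq> S \<and> (\<Sum>K\<in>D. Sup K - Inf K) < \<epsilon> / (L + 1)"
    have K: "Sup K - Inf K \<ge> 0 \<and> norm (f (Sup K) - f (Inf K)) \<le> L * (Sup K - Inf K)" if "K \<in> D" for K
    proof -
      have "D division_of \<Union>D" using D by blast
      note division_ofD(3,4)[OF this \<open>K \<in> D\<close>]
      then obtain u v where uv: "K = cbox u v" "cbox u v \<noteq> {}" by blast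
      then have "u \<le> v" by simp
      moreover have "cbox u v \<subseteq> S" using D \<open>K \<in> D\<close> uv(1) by blast
      ultimately have "u \<in> S" "v \<in> S" by (auto simp: subset_iff)
      then show ?thesis
        using lipschitz_onD[OF assms, of v u] uv \<open>u \<le> v\<close> by (simp add: dist_norm)
    qed
    have "(\<Sum>K\<in>D. norm (f (Sup K) - f (Inf K))) \<le> L * (\<Sum>K\<in>D. Sup K - Inf K)"
      unfolding sum_distrib_left using K by (intro sum_mono) blast
    also have "\<dots> \<le> (L + 1) * (\<Sum>K\<in>D. Sup K - Inf K)"
      using K by (intro mult_right_mono sum_nonneg) auto
    also have "\<dots> < \<epsilon>"
      using D \<open>L \<ge> 0\<close> by (simp add: field_simps)
    finally show "(\<Sum>K\<in>D. norm (f (Sup K) - f (Inf K))) < \<epsilon>" .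
  qed
qed

lemma negligible_outer_open:
  assumes "negligible N" "\<delta> > 0"
  obtains U where "open U" "N \<subseteq> U" "U \<in> lmeasurable" "measure lebesgue U < \<delta>"
proof -
  have N: "N \<in> sets lebesgue" "emeasure lebesgue N = 0"
    using assms(1) negligible_iff_null_sets by blast+
  obtain U where U: "open U" "N \<subseteq> U" "U - N \<in> lmeasurable" "emeasure lebesgue (U - N) < ennreal \<delta>"
    using sets_lebesgue_outer_open[OF N(1) assms(2)] .
  have "U = (U - N) \<union> N" using U(2) by auto
  moreover have "N \<in> lmeasurable" using assms(1) by (rule negligible_imp_measurable)
  ultimately have m: "U \<in> lmeasurable" using U(3) by (metis fmeasurable.Un)
  have "measure lebesgue U = measure lebesgue (U - N)"
    using assms(1) m N(1) by (simp add: measure_Diff_null_set negligible_iff_null_sets fmeasurableD)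
  also have "\<dots> < \<delta>"
    using U(3,4) assms(2) by (simp add: emeasure_eq_measure2 ennreal_less_iff)
  finally show ?thesis using that U m by blast
qed

text \<open>Lebesgue's version of the fundamental theorem of calculus. The gauge integral makes a direct
  proof possible, without differentiation of monotone functions: a gauge can be chosen separately
  at every tag. At tags outside \<^term>\<open>N\<close> the gauge forces the increments of \<^term>\<open>f\<close> to be close to
  those of its linearization; the intervals with tags in \<^term>\<open>N\<close> are confined to an open set of
  small measure, so that absolute continuity bounds their total contribution. The integrand may be
  replaced by zero on \<^term>\<open>N\<close>, where nothing is known about it.\<close>

theorem has_integral_derivative_abs_continuous:
  fixes f :: "real \<Rightarrow> 'b::real_normed_vector"
  assumes "a \<le> b" and ac: "abs_continuous_on {a..b} f" and "negligible N"
    and der: "\<And>x. x \<in> {a..b} - N \<Longrightarrow> (f has_vector_derivative h x) (at x within {a..b})"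
  shows "(h has_integral f b - f a) {a..b}"
proof -
  define h0 where "h0 = (\<lambda>x. if x \<in> N then 0 else h x)"
  have "(h0 has_integral f b - f a) {a..b}"
    unfolding has_integral_real
  proof (intro allI impI)
    fix \<epsilon> :: real assume "\<epsilon> > 0"
    \<comment> \<open>Half of \<^term>\<open>\<epsilon>\<close> is spent on the tags outside \<^term>\<open>N\<close>; the added 1 covers \<^term>\<open>a = b\<close>.\<close>
    define c where "c = \<epsilon> / 2 / (b - a + 1)"
    have "c > 0" using \<open>\<epsilon> > 0\<close> \<open>a \<le> b\<close> by (simp add: c_def)
    have "c * (b - a) \<le> \<epsilon> / 2"
      using \<open>\<epsilon> > 0\<close> \<open>a \<le> b\<close> by (simp add: c_def field_simps)
    have "\<epsilon> / 2 > 0" using \<open>\<epsilon> > 0\<close> by simp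
    obtain \<delta> where "\<delta> > 0" and \<delta>: "\<forall>D. D division_of (\<Union>D) \<and> \<Union>D \<subseteq> {a..b} \<and>
      (\<Sum>K\<in>D. Sup K - Inf K) < \<delta> \<longrightarrow> (\<Sum>K\<in>D. norm (f (Sup K) - f (Inf K))) < \<epsilon> / 2"
      using ac[unfolded abs_continuous_on_def] \<open>\<epsilon> / 2 > 0\<close> by blast
    obtain U where U: "open U" "N \<subseteq> U" "U \<in> lmeasurable" "measure lebesgue U < \<delta>"
      using negligible_outer_open[OF \<open>negligible N\<close> \<open>\<delta> > 0\<close>] .
    have "\<forall>x. \<exists>d>0. x \<in> {a..b} - N \<longrightarrow>
         (\<forall>y\<in>{a..b}. norm (y-x) < d \<longrightarrow> norm (f y - f x - (y-x) *\<^sub>R h x) \<le> c * norm (y-x))"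
      using der \<open>c > 0\<close> unfolding has_vector_derivative_def has_derivative_within_alt by (meson zero_less_one)
    then obtain d where d: "\<And>x. d x > 0"
      "\<And>x y. \<lbrakk>x \<in> {a..b} - N; y \<in> {a..b}; norm (y-x) < d x\<rbrakk>
         \<Longrightarrow> norm (f y - f x - (y-x) *\<^sub>R h x) \<le> c * norm (y-x)"
      by metis
    define \<gamma> where "\<gamma> = (\<lambda>x. if x \<in> N then U else ball x (d x))"
    have "gauge \<gamma>"
      using U d(1) unfolding gauge_def \<gamma>_def by auto
    moreover have "norm ((\<Sum>(x, K)\<in>p. measure lborel K *\<^sub>R h0 x) - (f b - f a)) < \<epsilon>"
      if p: "p tagged_division_of {a..b}" and fine: "\<gamma> fine p" for p
    proof -
      define q where "q = {(x, K) \<in> p. x \<in> N}"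
      define \<Delta> where "\<Delta> = (\<lambda>(x :: real, K). measure lborel K *\<^sub>R h0 x - (f (Sup K) - f (Inf K)))"
      have "finite p" using p by (rule tagged_division_of_finite)
      have "q \<subseteq> p" by (auto simp: q_def)
      have interval: "\<exists>u v. u \<le> v \<and> K = {u..v} \<and> x \<in> {u..v} \<and> {u..v} \<subseteq> {a..b}" if xK: "(x, K) \<in> p" for x K
      proof -
        obtain u v where "K = cbox u v" using tagged_division_ofD(4)[OF p xK] by blast
        moreover have "x \<in> K" "K \<subseteq> {a..b}" using tagged_division_ofD(2,3)[OF p xK] by auto
        ultimately show ?thesis by (intro exI[of _ u] exI[of _ v]) auto
      qed
      have length: "Sup K - Inf K = measure lebesgue K \<and> Inf K \<le> Sup K \<and> K \<subseteq> {a..b}" if "(x, K) \<in> p" for x K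
        using interval[OF that] by auto
      have bad: "norm (sum \<Delta> q) < \<epsilon> / 2"
      proof -
        have qpart: "q tagged_partial_division_of {a..b}"
          using p \<open>q \<subseteq> p\<close> tagged_partial_division_subset unfolding tagged_division_of_def by blast
        note qdiv = partial_division_of_tagged_division[OF qpart]
        have "(\<Sum>K\<in>snd ` q. Sup K - Inf K) = (\<Sum>K\<in>snd ` q. measure lebesgue K)"
          using length \<open>q \<subseteq> p\<close> by (intro sum.cong refl) auto
        also have "\<dots> = measure lebesgue (\<Union>(snd ` q))"
          by (rule content_division[OF qdiv])
        also have "\<dots> \<le> measure lebesgue U"
        proof (rule measure_mono_fmeasurable)
          show "\<Union> (snd ` q) \<subseteq> U"
            using fineD[OF fine] unfolding q_def \<gamma>_def by fastforce
          show "\<Union> (snd ` q) \<in> sets lebesgue"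
            using lmeasurable_division[OF qdiv] by blast
        qed (use U in simp)
        finally have len: "(\<Sum>K\<in>snd ` q. Sup K - Inf K) < \<delta>" using U(4) by simp
        \<comment> \<open>Absolute continuity speaks of a set of intervals, whereas a tagged division may repeat
          a degenerate interval with several tags; such intervals have increment zero.\<close>
        have "norm (sum \<Delta> q) \<le> (\<Sum>(x, K)\<in>q. norm (f (Sup K) - f (Inf K)))"
          by (rule sum_norm_le) (auto simp: \<Delta>_def q_def h0_def norm_minus_commute)
        also have "\<dots> = (\<Sum>(x, K)\<in>q. if K = {} then 0 else norm (f (Sup K) - f (Inf K)))"
          using interval \<open>q \<subseteq> p\<close> by (intro sum.cong refl) fastforce
        also have "\<dots> = (\<Sum>K\<in>snd ` q. if K = {} then 0 else norm (f (Sup K) - f (Inf K)))"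
        proof (rule sum.over_tagged_division_lemma[OF tagged_partial_division_of_Union_self[OF qpart]])
          fix u v :: real assume "box u v = {}"
          then have "v \<le> u" by simp
          then show "(if cbox u v = {} then 0 else norm (f (Sup (cbox u v)) - f (Inf (cbox u v)))) = 0"
            by (cases "u = v") simp_all
        qed
        also have "\<dots> \<le> (\<Sum>K\<in>snd ` q. norm (f (Sup K) - f (Inf K)))"
          by (intro sum_mono) simp
        also have "\<dots> < \<epsilon> / 2"
        proof (intro \<delta>[rule_format] conjI qdiv len)
          show "\<Union> (snd ` q) \<subseteq> {a..b}"
            using tagged_partial_division_ofD(3)[OF qpart] by fastforce
        qed
        finally show ?thesis .
      qed
      have good: "norm (sum \<Delta> (p - q)) \<le> \<epsilon> / 2"
      proof -
        have "norm (sum \<Delta> (p - q)) \<le> (\<Sum>(x, K)\<in>p - q. c * (Sup K - Inf K))"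
        proof (rule sum_norm_le, clarify)
          fix x K assume xK: "(x, K) \<in> p" "(x, K) \<notin> q"
          then have "x \<notin> N" by (auto simp: q_def)
          obtain u v where uv: "u \<le> v" "K = {u..v}" "x \<in> {u..v}" "{u..v} \<subseteq> {a..b}"
            using interval[OF xK(1)] by blast
          have sub: "{u..v} \<subseteq> ball x (d x)"
            using fineD[OF fine xK(1)] \<open>x \<notin> N\<close> uv(2) by (simp add: \<gamma>_def)
          have near: "norm (u - x) < d x" "norm (v - x) < d x"
            using subsetD[OF sub, of u] subsetD[OF sub, of v] uv by (auto simp: dist_real_def)
          have x: "x \<in> {a..b} - N" using uv \<open>x \<notin> N\<close> by auto
          have u: "norm (f u - f x - (u-x) *\<^sub>R h x) \<le> c * (x - u)"
            using d(2)[OF x _ near(1)] uv by auto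
          have v: "norm (f v - f x - (v-x) *\<^sub>R h x) \<le> c * (v - x)"
            using d(2)[OF x _ near(2)] uv by auto
          have "\<Delta> (x, K) = (f u - f x - (u-x) *\<^sub>R h x) - (f v - f x - (v-x) *\<^sub>R h x)"
            using uv \<open>x \<notin> N\<close> by (simp add: \<Delta>_def h0_def algebra_simps)
          then have "norm (\<Delta> (x, K)) \<le> c * (x - u) + c * (v - x)"
            using norm_triangle_ineq4 u v by (smt (verit))
          then show "norm (\<Delta> (x, K)) \<le> c * (Sup K - Inf K)"
            using uv by (simp add: algebra_simps)
        qed
        also have "\<dots> \<le> (\<Sum>(x, K)\<in>p. c * (Sup K - Inf K))"
          using \<open>finite p\<close> \<open>c > 0\<close> length by (intro sum_mono2) auto
        also have "\<dots> = c * (b - a)"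
          using additive_tagged_division_1[OF \<open>a \<le> b\<close> p, of "\<lambda>x. x"]
          by (simp add: sum_distrib_left[symmetric] case_prod_unfold)
        finally show ?thesis using \<open>c * (b - a) \<le> \<epsilon> / 2\<close> by simp
      qed
      have "(\<Sum>(x, K)\<in>p. measure lborel K *\<^sub>R h0 x) - (f b - f a) = sum \<Delta> p"
        using additive_tagged_division_1[OF \<open>a \<le> b\<close> p, of f]
        by (simp add: \<Delta>_def case_prod_unfold sum_subtractf)
      also have "\<dots> = sum \<Delta> q + sum \<Delta> (p - q)"
        using sum.subset_diff[OF \<open>q \<subseteq> p\<close> \<open>finite p\<close>] by (simp add: add.commute)
      finally show ?thesis
        using bad good norm_triangle_ineq[of "sum \<Delta> q" "sum \<Delta> (p - q)"] by simp
    qed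
    ultimately show "\<exists>\<gamma>. gauge \<gamma> \<and> (\<forall>p. p tagged_division_of {a..b} \<and> \<gamma> fine p \<longrightarrow>
        norm ((\<Sum>(x, K)\<in>p. measure lborel K *\<^sub>R h0 x) - (f b - f a)) < \<epsilon>)"
      by (intro exI[of _ \<gamma>] conjI allI impI) simp_all
  qed
  then show ?thesis
    by (rule has_integral_spike[OF \<open>negligible N\<close>, rotated]) (simp add: h0_def)
qed

text \<open>A continuous almost-everywhere derivative of an absolutely continuous function is its
  derivative everywhere, because such a function is an indefinite integral of it. This is what
  turns the almost-everywhere conditions on an extremal into differential equations.\<close>

lemma has_vector_derivative_abs_continuous_AE:
  fixes f :: "real \<Rightarrow> 'b::banach"
  assumes ac: "abs_continuous_on {a..b} f" and h: "continuous_on {a..b} h"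
    and der: "AE t in lebesgue. t \<in> {a<..<b} \<longrightarrow> (f has_vector_derivative h t) (at t)"
    and t: "t \<in> {a<..<b}"
  shows "(f has_vector_derivative h t) (at t)"
proof -
  obtain N where N: "negligible N" "\<And>s. s \<in> {a<..<b} - N \<Longrightarrow> (f has_vector_derivative h s) (at s)"
    using der unfolding eventually_ae_filter negligible_iff_null_sets by fastforce
  have f: "f s = f a + integral {a..s} h" if s: "s \<in> {a..b}" for s
  proof -
    have "(h has_integral f s - f a) {a..s}"
    proof (rule has_integral_derivative_abs_continuous)
      \<comment> \<open>The derivative is assumed at interior points only, so the endpoints join the null set.\<close>
      show "negligible (N \<union> {a, s})" using N(1) by (simp add: negligible_Un)
      show "abs_continuous_on {a..s} f" using ac s by (rule_tac abs_continuous_on_subset) auto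
      show "(f has_vector_derivative h x) (at x within {a..s})" if "x \<in> {a..s} - (N \<union> {a, s})" for x
        using N(2)[of x] that s by (auto intro: has_vector_derivative_at_within)
    qed (use s in simp)
    then show ?thesis by (simp add: integral_unique)
  qed
  have "((\<lambda>s. f a + integral {a..s} h) has_vector_derivative h t) (at t within {a..b})"
    using integral_has_vector_derivative[OF h, of t] t
      by (auto intro!: derivative_eq_intros)
  then have "(f has_vector_derivative h t) (at t within {a..b})"
    by (rule has_vector_derivative_transform[rotated 2]) (use t in simp, rule f)
  then show ?thesis
    using t by (simp add: at_within_Icc_at)
qed

text \<open>The set where two continuous functions differ is open, and a nonempty open set is not null.\<close>

lemma AE_lebesgue_imp_all_eq:
  fixes f g :: "'a::euclidean_space \<Rightarrow> 'b::t2_space"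
  assumes "continuous_on UNIV f" "continuous_on UNIV g" "AE t in lebesgue. f t = g t"
  shows "f t = g t"
proof -
  let ?D = "{t. f t \<noteq> g t}"
  have op: "open ?D" using assms(1,2) by (rule open_Collect_neq)
  have "?D \<in> null_sets lebesgue"
    using assms(3) AE_iff_null_sets[of ?D lebesgue] op by (auto simp: borel_open)
  then have "?D = {}"
    using open_not_negligible[OF op] by (auto simp: negligible_iff_null_sets)
  then show ?thesis by blast
qed


section \<open>Smooth functions along Lipschitz curves\<close>

text \<open>Continuity of the partial derivatives bounds the operator norm of the derivative on a compact
  ball, and the mean value inequality applies on the convex open ball inside it.\<close>

lemma smooth_on_locally_lipschitz:
  assumes "smooth_on S f" "open S" "x \<in> S"
  obtains d L where "d > 0" "ball x d \<subseteq> S" "L-lipschitz_on (ball x d) f"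
proof -
  have "Ck_on (Suc 0) S f" using assms(1) unfolding smooth_on_def by blast
  then have diff: "\<And>y. y \<in> S \<Longrightarrow> f differentiable (at y)"
    and cont: "\<And>v. continuous_on S (\<lambda>y. frechet_derivative f (at y) v)" by simp_all
  obtain d where "d > 0" and d: "cball x d \<subseteq> S"
    using assms(2,3) open_contains_cball by blast
  define N where "N = (\<lambda>y. \<Sum>b\<in>Basis. norm (frechet_derivative f (at y) b))"
  have "continuous_on (cball x d) N"
    unfolding N_def by (intro continuous_intros continuous_on_subset[OF cont d])
  then have "bounded (N ` cball x d)"
    by (intro compact_imp_bounded compact_continuous_image compact_cball)
  then obtain M where "\<forall>z\<in>N ` cball x d. norm z \<le> M"
    unfolding bounded_iff by blast
  then have M: "N y \<le> M" if "y \<in> cball x d" for y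
    using that by (simp add: abs_le_iff)
  have "norm (f y - f z) \<le> max M 0 * norm (y - z)" if "y \<in> ball x d" "z \<in> ball x d" for y z
  proof (rule differentiable_bound[OF convex_ball[of x d]])
    fix w assume w: "w \<in> ball x d"
    then have "w \<in> S" using d by (auto simp: subset_iff)
    then have der: "(f has_derivative frechet_derivative f (at w)) (at w)"
      using diff frechet_derivative_works by blast
    then show "(f has_derivative frechet_derivative f (at w)) (at w within ball x d)"
      by (rule has_derivative_at_withinI)
    have "onorm (frechet_derivative f (at w)) \<le> N w"
      unfolding N_def using der by (intro onorm_componentwise has_derivative_bounded_linear)
    also have "N w \<le> M" using w by (intro M) simp
    finally show "onorm (frechet_derivative f (at w)) \<le> max M 0" by simp
  qed (use that in auto)
  then have "(max M 0)-lipschitz_on (ball x d) f"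
    by (intro lipschitz_onI) (simp_all add: dist_norm)
  moreover have "ball x d \<subseteq> S" using d ball_subset_cball by blast
  ultimately show ?thesis using that \<open>d > 0\<close> by blast
qed

text \<open>The Lipschitz condition on a curve is stated in charts. Near a given time, \<open>f \<circ> g\<close> factors
  through a chart into the coordinate expression of \<^term>\<open>f\<close>, which is locally Lipschitz by
  smoothness, and the coordinate expression of \<^term>\<open>g\<close>.\<close>

lemma smooth_fun_along_lipschitz_curve:
  assumes "smooth_manifold (atlas G)" "lipschitz_curve G g" "f \<in> smooth_funs G"
  obtains d L where "d > 0" "L-lipschitz_on (ball t d) (\<lambda>s. f (g s))"
proof -
  obtain U \<phi> where U: "(U, \<phi>) \<in> atlas G" "g t \<in> U"
    using assms(1) unfolding smooth_manifold_def by blast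
  have "is_chart U \<phi>" using assms(1) U(1) unfolding smooth_manifold_def by blast
  then have opn: "open (\<phi> ` U)" and inv: "\<And>y. y \<in> U \<Longrightarrow> inv_into U \<phi> (\<phi> y) = y"
    unfolding is_chart_def homeomorphism_def by blast+
  obtain d1 L1 where d1: "d1 > 0" "g ` ball t d1 \<subseteq> U" and L1: "L1-lipschitz_on (ball t d1) (\<phi> \<circ> g)"
  proof -
    have "\<exists>d>0. \<exists>L. g ` ball t d \<subseteq> U \<and> L-lipschitz_on (ball t d) (\<phi> \<circ> g)"
      using assms(2)[unfolded lipschitz_curve_def, THEN spec, THEN bspec, OF U(1)] U(2) by simp
    then show ?thesis using that by blast
  qed
  have "L1 \<ge> 0" using L1 by (rule lipschitz_on_nonneg)
  have "smooth_on (\<phi> ` (U \<inter> f -` UNIV)) (id \<circ> f \<circ> inv_into U \<phi>)"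
    using assms(3) U(1) unfolding smooth_funs_def smooth_map_def by blast
  then have "smooth_on (\<phi> ` U) (f \<circ> inv_into U \<phi>)" by simp
  then obtain d2 L2 where d2: "d2 > 0" and L2: "L2-lipschitz_on (ball (\<phi> (g t)) d2) (f \<circ> inv_into U \<phi>)"
    using smooth_on_locally_lipschitz[OF _ opn] U(2) by blast
  define d where "d = min d1 (d2 / (L1 + 1))"
  have "d > 0" using d1 d2 \<open>L1 \<ge> 0\<close> by (simp add: d_def)
  have near: "(\<phi> \<circ> g) ` ball t d \<subseteq> ball (\<phi> (g t)) d2"
  proof clarify
    fix s assume s: "s \<in> ball t d"
    have "dist ((\<phi> \<circ> g) t) ((\<phi> \<circ> g) s) \<le> L1 * dist t s"
      using s d1(1) by (intro lipschitz_onD[OF L1]) (auto simp: d_def)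
    also have "\<dots> \<le> (L1 + 1) * dist t s" by (intro mult_right_mono) simp_all
    also have "\<dots> < d2" using s \<open>L1 \<ge> 0\<close> by (simp add: d_def field_simps)
    finally show "(\<phi> \<circ> g) s \<in> ball (\<phi> (g t)) d2" by simp
  qed
  have "(L2 * L1)-lipschitz_on (ball t d) ((f \<circ> inv_into U \<phi>) \<circ> (\<phi> \<circ> g))"
  proof (rule lipschitz_on_compose)
    show "L1-lipschitz_on (ball t d) (\<phi> \<circ> g)"
      using L1 by (rule lipschitz_on_subset) (auto simp: d_def)
    show "L2-lipschitz_on ((\<phi> \<circ> g) ` ball t d) (f \<circ> inv_into U \<phi>)"
      using L2 near by (rule lipschitz_on_subset)
  qed
  moreover have "((f \<circ> inv_into U \<phi>) \<circ> (\<phi> \<circ> g)) s = f (g s)" if "s \<in> ball t d" for s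
    using that d1(2) by (auto simp: d_def image_subset_iff inv)
  ultimately have "(L2 * L1)-lipschitz_on (ball t d) (\<lambda>s. f (g s))"
    by (simp add: lipschitz_on_def)
  then show ?thesis using that \<open>d > 0\<close> by blast
qed

lemma continuous_smooth_fun_along_lipschitz_curve:
  assumes "smooth_manifold (atlas G)" "lipschitz_curve G g" "f \<in> smooth_funs G"
  shows "continuous_on UNIV (\<lambda>s. f (g s))"
  unfolding continuous_on_eq_continuous_at[OF open_UNIV]
proof
  fix t
  obtain d L where "d > 0" "L-lipschitz_on (ball t d) (\<lambda>s. f (g s))"
    using smooth_fun_along_lipschitz_curve[OF assms] by blast
  then show "isCont (\<lambda>s. f (g s)) t"
    using continuous_on_interior[OF lipschitz_on_continuous_on, of L "ball t d" "\<lambda>s. f (g s)" t] by simp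
qed

text \<open>Velocities are tested on smooth functions, so this upgrades a velocity that exists almost
  everywhere to one that exists everywhere, provided that its candidate value is continuous in time.\<close>

lemma has_real_derivative_smooth_fun_along_lipschitz_curve:
  assumes "smooth_manifold (atlas G)" "lipschitz_curve G g" "f \<in> smooth_funs G"
    and "continuous_on UNIV h"
    and "AE t in lebesgue. ((\<lambda>s. f (g s)) has_real_derivative h t) (at t)"
  shows "((\<lambda>s. f (g s)) has_real_derivative h t) (at t)"
proof -
  obtain d L where d: "d > 0" "L-lipschitz_on (ball t d) (\<lambda>s. f (g s))"
    using smooth_fun_along_lipschitz_curve[OF assms(1-3)] by blast
  have "((\<lambda>s. f (g s)) has_vector_derivative h t) (at t)"
  proof (rule has_vector_derivative_abs_continuous_AE)
    show "abs_continuous_on {t - d/2..t + d/2} (\<lambda>s. f (g s))"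
    proof (rule lipschitz_on_imp_abs_continuous_on, rule lipschitz_on_subset[OF d(2)])
      show "{t - d/2..t + d/2} \<subseteq> ball t d"
        using d(1) by (auto simp: dist_real_def)
    qed
    show "continuous_on {t - d/2..t + d/2} h"
      using assms(4) by (rule continuous_on_subset) simp
    show "AE s in lebesgue. s \<in> {t - d/2<..<t + d/2} \<longrightarrow>
        ((\<lambda>s. f (g s)) has_vector_derivative h s) (at s)"
      using assms(5) by eventually_elim (simp add: has_real_derivative_iff_has_vector_derivative)
  qed (use d in simp)
  then show ?thesis by (simp add: has_real_derivative_iff_has_vector_derivative)
qed

section \<open>Left-invariant vector fields\<close>

text \<open>Covectors, the form and the bracket are known to be linear on the Lie algebra only, which is
  a subspace of the space of all functions with the type of a vector field.\<close>

lemma linear_on_subspace_sum: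
  fixes F :: "'v::real_vector \<Rightarrow> 'w::real_vector"
  assumes "subspace L"
    and add: "\<And>x y. x \<in> L \<Longrightarrow> y \<in> L \<Longrightarrow> F (x + y) = F x + F y"
    and scale: "\<And>c x. x \<in> L \<Longrightarrow> F (c *\<^sub>R x) = c *\<^sub>R F x"
    and "\<And>i. i \<in> I \<Longrightarrow> X i \<in> L"
  shows "F (\<Sum>i\<in>I. c i *\<^sub>R X i) = (\<Sum>i\<in>I. c i *\<^sub>R F (X i))"
  using assms(4)
proof (induction I rule: infinite_finite_induct)
  case (insert i I)
  then have "(\<Sum>i\<in>I. c i *\<^sub>R X i) \<in> L" "c i *\<^sub>R X i \<in> L"
    using assms(1) by (auto intro!: subspace_sum subspace_scale)
  then show ?case using insert by (simp add: add scale)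
qed (use scale[OF subspace_0[OF assms(1)], of 0] in simp_all)

text \<open>Left invariance: the field is determined by its value at the identity, so that the velocity
  condition on a curve compares its derivative with the value of the field at the current point.\<close>

lemma dl_eq:
  assumes "lie_group G" "X \<in> lie_algebra G"
  shows "dl G a X = X a"
proof -
  have "monoid G" "carrier G = UNIV" using assms(1) by (auto simp: lie_group_def group.is_monoid)
  then have "left_shift G a \<one>\<^bsub>G\<^esub> = a" by (simp add: left_shift_def monoid.r_one)
  then show ?thesis using assms(2) unfolding dl_def lie_algebra_def by auto
qed

lemma lie_algebra_tangent:
  assumes "X \<in> lie_algebra G"
  shows "X p \<in> tangent_space G p"
  using assms[unfolded lie_algebra_def, THEN CollectD, THEN conjunct1, THEN spec] .

lemma lie_algebra_smooth:
  assumes "X \<in> lie_algebra G" "f \<in> smooth_funs G"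
  shows "(\<lambda>p. X p f) \<in> smooth_funs G"
  using assms(1)[unfolded lie_algebra_def, THEN CollectD, THEN conjunct2, THEN conjunct1, THEN bspec, OF assms(2)] .

lemma tangent_space_add:
  assumes "v \<in> tangent_space G p" "f \<in> smooth_funs G" "h \<in> smooth_funs G"
  shows "v (f + h) = v f + v h"
  using assms(1)[unfolded tangent_space_def, THEN CollectD, THEN conjunct1, THEN bspec, OF assms(2), THEN bspec, OF assms(3)] .

lemma tangent_space_scaleR:
  assumes "v \<in> tangent_space G p" "f \<in> smooth_funs G"
  shows "v (c *\<^sub>R f) = c * v f"
  using assms(1)[unfolded tangent_space_def, THEN CollectD, THEN conjunct2, THEN conjunct1, THEN bspec, OF assms(2), THEN spec] .

text \<open>The left argument of the bracket is also differentiated by the right one, which requires that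
  derivatives of smooth functions along left-invariant fields are smooth.\<close>

lemma bracket_add_left:
  assumes "X \<in> lie_algebra G" "X' \<in> lie_algebra G" "Y \<in> lie_algebra G"
  shows "bracket G (X + X') Y = bracket G X Y + bracket G X' Y"
proof (intro ext)
  fix p f
  show "bracket G (X + X') Y p f = (bracket G X Y + bracket G X' Y) p f"
  proof (cases "f \<in> smooth_funs G")
    case True
    have "Y p ((\<lambda>q. X q f) + (\<lambda>q. X' q f)) = Y p (\<lambda>q. X q f) + Y p (\<lambda>q. X' q f)"
      by (rule tangent_space_add[OF lie_algebra_tangent[OF assms(3)]
          lie_algebra_smooth[OF assms(1) True] lie_algebra_smooth[OF assms(2) True]])
    then show ?thesis using True by (simp add: bracket_def plus_fun_def)
  qed (simp add: bracket_def)
qed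

lemma bracket_scaleR_left:
  assumes "X \<in> lie_algebra G" "Y \<in> lie_algebra G"
  shows "bracket G (c *\<^sub>R X) Y = c *\<^sub>R bracket G X Y"
proof (intro ext)
  fix p f
  show "bracket G (c *\<^sub>R X) Y p f = (c *\<^sub>R bracket G X Y) p f"
  proof (cases "f \<in> smooth_funs G")
    case True
    have "Y p (c *\<^sub>R (\<lambda>q. X q f)) = c * Y p (\<lambda>q. X q f)"
      by (rule tangent_space_scaleR[OF lie_algebra_tangent[OF assms(2)] lie_algebra_smooth[OF assms(1) True]])
    then show ?thesis using True by (simp add: bracket_def scaleR_fun_def algebra_simps)
  qed (simp add: bracket_def)
qed


section \<open>Orthonormal frames and the minimum condition\<close>

locale orthonormal_frame =
  fixes G :: "('a::{t2_space, second_countable_topology}, 'e::euclidean_space) smooth_group"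
    and \<pp> :: "'a vfield set"
    and B :: "'a vfield \<Rightarrow> 'a vfield \<Rightarrow> real"
    and n r :: nat
    and e :: "nat \<Rightarrow> 'a vfield"
  assumes sub_lor: "sub_lorentzian G \<pp> B n r e"
begin

text \<open>The diagonal entries of the form in the frame. They are their own inverses, so that they also
  occur in the coordinates of a vector.\<close>

definition sig :: "nat \<Rightarrow> real" where "sig i = (if i = 0 then 1 else - 1)"

lemma sig_square [simp]: "sig i * sig i = 1"
  by (simp add: sig_def)

lemma lie_group: "lie_group G"
  using sub_lor by (simp add: sub_lorentzian_def)

lemma r_le_n: "r \<le> n"
  using sub_lor by (simp add: sub_lorentzian_def)

lemma span_frame: "span (e ` {0..n}) = lie_algebra G"
  using sub_lor by (simp add: sub_lorentzian_def)

lemma span_horizontal_frame: "span (e ` {0..r}) = \<pp>"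
  using sub_lor by (simp add: sub_lorentzian_def)

lemma horizontal_subset: "\<pp> \<subseteq> lie_algebra G"
  using sub_lor by (simp add: sub_lorentzian_def)

lemma subspace_lie_algebra: "subspace (lie_algebra G)"
  unfolding span_frame[symmetric] by (rule subspace_span)

lemma frame_in_lie_algebra: "i \<le> n \<Longrightarrow> e i \<in> lie_algebra G"
  unfolding span_frame[symmetric] by (rule span_base) simp

lemma frame_sum_in_lie_algebra: "m \<le> n \<Longrightarrow> (\<Sum>i=0..m. c i *\<^sub>R e i) \<in> lie_algebra G"
  by (intro subspace_sum subspace_scale subspace_lie_algebra frame_in_lie_algebra) simp

lemma frame_orthonormal:
  "i \<le> n \<Longrightarrow> j \<le> n \<Longrightarrow> B (e i) (e j) = (if i = j then sig i else 0)"
  using sub_lor by (auto simp: sub_lorentzian_def sig_def)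

lemma covector_sum:
  assumes "\<xi> \<in> lie_dual G" "\<And>i. i \<in> I \<Longrightarrow> X i \<in> lie_algebra G"
  shows "\<xi> (\<Sum>i\<in>I. c i *\<^sub>R X i) = (\<Sum>i\<in>I. c i * \<xi> (X i))"
proof -
  have "\<xi> (\<Sum>i\<in>I. c i *\<^sub>R X i) = (\<Sum>i\<in>I. c i *\<^sub>R \<xi> (X i))"
  proof (rule linear_on_subspace_sum[OF subspace_lie_algebra])
    show "\<And>x y. x \<in> lie_algebra G \<Longrightarrow> y \<in> lie_algebra G \<Longrightarrow> \<xi> (x + y) = \<xi> x + \<xi> y"
      using assms(1) by (auto simp: lie_dual_def)
    show "\<And>c x. x \<in> lie_algebra G \<Longrightarrow> \<xi> (c *\<^sub>R x) = c *\<^sub>R \<xi> x"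
      using assms(1) by (auto simp: lie_dual_def)
  qed (rule assms(2))
  then show ?thesis by simp
qed

lemma form_in_lie_dual: "X \<in> lie_algebra G \<Longrightarrow> B X \<in> lie_dual G"
  using sub_lor by (simp add: sub_lorentzian_def symmetric_bilinear_form_def)

lemma form_sym: "X \<in> lie_algebra G \<Longrightarrow> Y \<in> lie_algebra G \<Longrightarrow> B X Y = B Y X"
  using sub_lor by (simp add: sub_lorentzian_def symmetric_bilinear_form_def)

lemma form_frame_sum:
  assumes "m \<le> n" "Y \<in> lie_algebra G"
  shows "B (\<Sum>i=0..m. c i *\<^sub>R e i) Y = (\<Sum>i=0..m. c i * B Y (e i))"
proof -
  have "B (\<Sum>i=0..m. c i *\<^sub>R e i) Y = B Y (\<Sum>i=0..m. c i *\<^sub>R e i)"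
    using assms by (intro form_sym frame_sum_in_lie_algebra)
  also have "\<dots> = (\<Sum>i=0..m. c i * B Y (e i))"
    using assms by (intro covector_sum form_in_lie_dual frame_in_lie_algebra) simp_all
  finally show ?thesis .
qed

lemma form_frame_sum_coord:
  assumes "m \<le> n" "j \<le> m"
  shows "B (\<Sum>i=0..m. c i *\<^sub>R e i) (e j) = sig j * c j"
proof -
  have "B (\<Sum>i=0..m. c i *\<^sub>R e i) (e j) = (\<Sum>i=0..m. c i * B (e j) (e i))"
    using assms by (intro form_frame_sum frame_in_lie_algebra) simp_all
  also have "\<dots> = (\<Sum>i=0..m. if i = j then sig j * c j else 0)"
    using assms by (intro sum.cong) (auto simp: frame_orthonormal)
  finally show ?thesis using assms by (simp add: sum.delta)
qed

lemma frame_expansion: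
  assumes "m \<le> n" "X \<in> span (e ` {0..m})"
  shows "X = (\<Sum>i=0..m. (sig i * B X (e i)) *\<^sub>R e i)"
proof -
  have *: "\<exists>c. X = (\<Sum>i=0..m. c i *\<^sub>R e i)"
    using assms(2)
  proof (induction rule: span_induct_alt)
    case base
    show ?case by (rule exI[of _ "\<lambda>_. 0"]) simp
  next
    case (step a x y)
    obtain c where y: "y = (\<Sum>i=0..m. c i *\<^sub>R e i)" using step.IH ..
    obtain j where j: "x = e j" "j \<le> m" using step.hyps by (auto simp only: image_iff atLeastAtMost_iff)
    have "x = (\<Sum>i=0..m. (if i = j then 1 else 0) *\<^sub>R e i)"
      using j by (simp add: if_distrib[of "\<lambda>c. c *\<^sub>R _"] sum.delta cong: if_cong)
    then have "a *\<^sub>R x + y = (\<Sum>i=0..m. (a * (if i = j then 1 else 0) + c i) *\<^sub>R e i)"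
      using y by (simp add: scaleR_left_distrib sum.distrib scaleR_right.sum)
    then show ?case by (rule exI[of _ "\<lambda>i. a * (if i = j then 1 else 0) + c i"])
  qed
  then obtain c where c: "X = (\<Sum>i=0..m. c i *\<^sub>R e i)" ..
  have "sig i * B X (e i) = c i" if "i \<le> m" for i
    using form_frame_sum_coord[OF assms(1) that, of c, folded c] by (simp add: mult.assoc[symmetric])
  then have "(\<Sum>i=0..m. (sig i * B X (e i)) *\<^sub>R e i) = (\<Sum>i=0..m. c i *\<^sub>R e i)"
    by (intro sum.cong) simp_all
  with c show ?thesis by (rule trans[OF _ sym])
qed

text \<open>The frame expansion yields both the existence and the uniqueness of the vector that represents
  a covector, so that the definite description is meaningful.\<close>

lemma covector_to_vector_form:
  assumes "\<xi> \<in> lie_dual G" "Y \<in> lie_algebra G"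
  shows "B (covector_to_vector G B \<xi>) Y = \<xi> Y"
proof -
  let ?P = "\<lambda>X. X \<in> lie_algebra G \<and> (\<forall>Y\<in>lie_algebra G. B X Y = \<xi> Y)"
  let ?R = "\<Sum>i=0..n. (sig i * \<xi> (e i)) *\<^sub>R e i"
  have R: "?P ?R"
  proof (intro conjI ballI frame_sum_in_lie_algebra order_refl)
    fix Y assume Y: "Y \<in> lie_algebra G"
    have "B ?R Y = (\<Sum>i=0..n. (sig i * B Y (e i)) * \<xi> (e i))"
      using form_frame_sum[OF order_refl Y] by (simp add: mult_ac)
    also have "\<dots> = \<xi> (\<Sum>i=0..n. (sig i * B Y (e i)) *\<^sub>R e i)"
      using assms(1) frame_in_lie_algebra by (intro covector_sum[symmetric]) simp_all
    also have "\<dots> = \<xi> Y"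
      using frame_expansion[OF order_refl, of Y] Y span_frame by simp
    finally show "B ?R Y = \<xi> Y" .
  qed
  have uniq: "X = ?R" if X: "?P X" for X
  proof -
    have "X = (\<Sum>i=0..n. (sig i * B X (e i)) *\<^sub>R e i)"
      using X span_frame by (intro frame_expansion) simp_all
    also have "\<dots> = ?R"
      using X frame_in_lie_algebra by (intro sum.cong) simp_all
    finally show ?thesis .
  qed
  have "?P (THE X. ?P X)" by (rule theI[of ?P, OF R uniq])
  then show ?thesis using assms(2) by (simp add: covector_to_vector_def)
qed

text \<open>For \<open>r = n\<close> this is the vector identified with \<^term>\<open>\<xi>\<close>; in general it is the orthogonal
  projection of that vector to the horizontal subspace. The signs keep it a single sum
  over the frame, to which the linearity lemmas apply.\<close>

definition control :: "('a vfield \<Rightarrow> real) \<Rightarrow> 'a vfield"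
  where "control \<xi> = (\<Sum>i=0..r. (sig i * \<xi> (e i)) *\<^sub>R e i)"

lemma control_eq: "control \<xi> = \<xi> (e 0) *\<^sub>R e 0 - (\<Sum>i=1..r. \<xi> (e i) *\<^sub>R e i)"
proof -
  have "control \<xi> = \<xi> (e 0) *\<^sub>R e 0 + (\<Sum>i=1..r. (sig i * \<xi> (e i)) *\<^sub>R e i)"
    by (simp add: control_def sum.atLeast_Suc_atMost sig_def)
  also have "(\<Sum>i=1..r. (sig i * \<xi> (e i)) *\<^sub>R e i) = (\<Sum>i=1..r. - (\<xi> (e i) *\<^sub>R e i))"
    by (intro sum.cong) (auto simp: sig_def)
  finally show ?thesis by (simp only: sum_negf add_uminus_conv_diff)
qed

lemma control_in_lie_algebra: "control \<xi> \<in> lie_algebra G"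
  unfolding control_def using r_le_n by (rule frame_sum_in_lie_algebra)

lemma control_form: "B (control \<xi>) (control \<xi>) = (\<xi> (e 0))\<^sup>2 - (\<Sum>i=1..r. (\<xi> (e i))\<^sup>2)"
proof -
  have "B (control \<xi>) (control \<xi>) = (\<Sum>i=0..r. sig i * \<xi> (e i) * B (control \<xi>) (e i))"
    using form_frame_sum[OF r_le_n control_in_lie_algebra] by (simp add: control_def)
  also have "\<dots> = (\<Sum>i=0..r. sig i * (\<xi> (e i))\<^sup>2)"
  proof (intro sum.cong refl)
    fix i assume "i \<in> {0..r}"
    then have "B (control \<xi>) (e i) = sig i * (sig i * \<xi> (e i))"
      unfolding control_def using r_le_n by (intro form_frame_sum_coord) simp_all
    then show "sig i * \<xi> (e i) * B (control \<xi>) (e i) = sig i * (\<xi> (e i))\<^sup>2"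
      by (simp add: power2_eq_square sig_def)
  qed
  also have "\<dots> = (\<xi> (e 0))\<^sup>2 + (\<Sum>i=1..r. sig i * (\<xi> (e i))\<^sup>2)"
    by (simp add: sum.atLeast_Suc_atMost sig_def)
  also have "(\<Sum>i=1..r. sig i * (\<xi> (e i))\<^sup>2) = (\<Sum>i=1..r. - (\<xi> (e i))\<^sup>2)"
    by (intro sum.cong) (auto simp: sig_def)
  finally show ?thesis by (simp add: sum_negf)
qed

text \<open>For \<open>\<Sum> a i\<^sup>2 = 1\<close> these are the admissible vectors \<open>w\<close> of the minimum condition. The sign is
  chosen such that the minimizer has \<open>a i = \<xi> (e i)\<close>.\<close>

lemma spacelike_horizontal_vector:
  fixes a :: "nat \<Rightarrow> real"
  defines "w \<equiv> - (\<Sum>i=1..r. a i *\<^sub>R e i)"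
  shows "w \<in> \<pp>" "B w (e 0) = 0" "B w w = - (\<Sum>i=1..r. (a i)\<^sup>2)"
    "\<xi> \<in> lie_dual G \<Longrightarrow> \<xi> w = - (\<Sum>i=1..r. a i * \<xi> (e i))"
proof -
  define c where "c i = (if i = 0 then 0 else - a i)" for i
  have w: "w = (\<Sum>i=0..r. c i *\<^sub>R e i)"
  proof -
    have "(\<Sum>i=0..r. c i *\<^sub>R e i) = (\<Sum>i=1..r. c i *\<^sub>R e i)"
      by (simp add: sum.atLeast_Suc_atMost c_def)
    also have "\<dots> = (\<Sum>i=1..r. - (a i *\<^sub>R e i))"
      by (intro sum.cong) (auto simp: c_def)
    finally show ?thesis by (simp add: w_def sum_negf)
  qed
  show "w \<in> \<pp>"
    unfolding w span_horizontal_frame[symmetric]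
    by (intro span_sum span_scale span_base) simp
  then have L: "w \<in> lie_algebra G" using horizontal_subset by blast
  have coord: "B w (e i) = sig i * c i" if "i \<le> r" for i
    unfolding w using form_frame_sum_coord[OF r_le_n that] .
  show "B w (e 0) = 0" using coord[of 0] by (simp add: c_def)
  have "B w w = (\<Sum>i=0..r. c i * B w (e i))"
    using form_frame_sum[OF r_le_n L, of c] w by simp
  also have "\<dots> = (\<Sum>i=1..r. c i * B w (e i))"
    by (simp add: sum.atLeast_Suc_atMost c_def)
  also have "\<dots> = (\<Sum>i=1..r. - (a i)\<^sup>2)"
    by (intro sum.cong) (auto simp: coord c_def sig_def power2_eq_square)
  finally show "B w w = - (\<Sum>i=1..r. (a i)\<^sup>2)" by (simp add: sum_negf)
  show "\<xi> w = - (\<Sum>i=1..r. a i * \<xi> (e i))" if "\<xi> \<in> lie_dual G"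
  proof -
    have "\<xi> w = (\<Sum>i=0..r. c i * \<xi> (e i))"
      unfolding w using that r_le_n frame_in_lie_algebra by (intro covector_sum) simp_all
    also have "\<dots> = (\<Sum>i=1..r. c i * \<xi> (e i))"
      by (simp add: sum.atLeast_Suc_atMost c_def)
    also have "\<dots> = (\<Sum>i=1..r. - (a i * \<xi> (e i)))"
      by (intro sum.cong) (auto simp: c_def)
    finally show ?thesis by (simp add: sum_negf)
  qed
qed

text \<open>On the unit sphere of the spacelike horizontal directions a covector is a Euclidean linear
  functional, whose minimum is minus the length of its restriction. The value \<open>- 1\<close> therefore says
  that the restriction has length one, and the equality case of the Cauchy-Schwarz
  inequality identifies the minimizer.\<close>

lemma minimizer_eq_control:
  assumes \<xi>: "\<xi> \<in> lie_dual G" "\<xi> (e 0) = 1"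
    and min: "is_arg_min (B (covector_to_vector G B \<xi>)) (\<lambda>w. w \<in> unit_space_vectors \<pp> B (e 0)) (u - e 0)"
    and val: "B (covector_to_vector G B \<xi>) (u - e 0) = - 1"
  shows "u = control \<xi>" "(\<Sum>i=1..r. (\<xi> (e i))\<^sup>2) = 1"
proof -
  let ?S = "\<Sum>i=1..r. (\<xi> (e i))\<^sup>2"
  define w where "w = u - e 0"
  define a where "a i = B w (e i)" for i
  have W: "w \<in> \<pp>" "B w (e 0) = 0" "B w w = - 1"
    using min by (simp_all add: is_arg_min_def unit_space_vectors_def w_def)
  have "w = (\<Sum>i=0..r. (sig i * a i) *\<^sub>R e i)"
    unfolding a_def using frame_expansion[OF r_le_n] W(1) span_horizontal_frame by simp
  also have "\<dots> = (\<Sum>i=1..r. (sig i * a i) *\<^sub>R e i)"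
    using W(2) by (simp add: sum.atLeast_Suc_atMost a_def)
  also have "\<dots> = (\<Sum>i=1..r. - (a i *\<^sub>R e i))"
    by (intro sum.cong) (auto simp: sig_def)
  finally have w: "w = - (\<Sum>i=1..r. a i *\<^sub>R e i)" by (simp add: sum_negf)
  have aa: "(\<Sum>i=1..r. (a i)\<^sup>2) = 1"
    using W(3) spacelike_horizontal_vector(3)[of a] w by simp
  have cov: "B (covector_to_vector G B \<xi>) v = \<xi> v" if "v \<in> \<pp>" for v
    using that horizontal_subset by (intro covector_to_vector_form \<xi>(1)) blast
  have "\<xi> w = - 1" using val cov[OF W(1)] by (simp add: w_def)
  then have a\<xi>: "(\<Sum>i=1..r. a i * \<xi> (e i)) = 1"
    using spacelike_horizontal_vector(4)[OF \<xi>(1), of a] w by simp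
  have "(\<Sum>i=1..r. (\<xi> (e i) - a i)\<^sup>2) = (\<Sum>i=1..r. (\<xi> (e i))\<^sup>2 + (a i)\<^sup>2 - 2 * (a i * \<xi> (e i)))"
    by (intro sum.cong refl) (simp add: power2_diff)
  also have "\<dots> = ?S + (\<Sum>i=1..r. (a i)\<^sup>2) - 2 * (\<Sum>i=1..r. a i * \<xi> (e i))"
    by (simp only: sum.distrib sum_subtractf sum_distrib_left)
  finally have diff: "(\<Sum>i=1..r. (\<xi> (e i) - a i)\<^sup>2) = ?S - 1"
    unfolding aa a\<xi> by simp
  moreover have "(\<Sum>i=1..r. (\<xi> (e i) - a i)\<^sup>2) \<ge> 0" by (intro sum_nonneg) simp
  ultimately have "?S \<ge> 1" by simp
  \<comment> \<open>Comparison with the unit vector opposite to the restriction of \<^term>\<open>\<xi>\<close>.\<close>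
  have "sqrt ?S \<le> 1"
  proof -
    define v where "v = - (\<Sum>i=1..r. (\<xi> (e i) / sqrt ?S) *\<^sub>R e i)"
    have "(\<Sum>i=1..r. (\<xi> (e i) / sqrt ?S)\<^sup>2) = 1"
      using \<open>?S \<ge> 1\<close> by (simp add: power_divide sum_divide_distrib[symmetric])
    then have "v \<in> unit_space_vectors \<pp> B (e 0)"
      using spacelike_horizontal_vector(1-3)[of "\<lambda>i. \<xi> (e i) / sqrt ?S"]
      by (simp add: v_def unit_space_vectors_def)
    moreover have "\<xi> v = - sqrt ?S"
    proof -
      have "\<xi> v = - (\<Sum>i=1..r. \<xi> (e i) / sqrt ?S * \<xi> (e i))"
        unfolding v_def by (rule spacelike_horizontal_vector(4)[OF \<xi>(1)])
      also have "\<dots> = - (?S / sqrt ?S)"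
        by (simp add: power2_eq_square sum_divide_distrib)
      also have "\<dots> = - sqrt ?S"
        using \<open>?S \<ge> 1\<close> by (simp add: real_div_sqrt)
      finally show ?thesis .
    qed
    ultimately show ?thesis
      using min val cov[of v] by (fastforce simp: is_arg_min_def unit_space_vectors_def)
  qed
  then show "?S = 1" using \<open>?S \<ge> 1\<close> by simp
  then have "(\<Sum>i=1..r. (\<xi> (e i) - a i)\<^sup>2) = 0" using diff by simp
  then have "\<xi> (e i) = a i" if "i \<in> {1..r}" for i
    using that by (subst (asm) sum_nonneg_eq_0_iff) auto
  then have "w = - (\<Sum>i=1..r. \<xi> (e i) *\<^sub>R e i)"
    using w by simp
  then show "u = control \<xi>"
    unfolding control_eq using \<xi>(2) by (simp add: w_def algebra_simps)
qed

lemma bracket_control: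
  assumes C: "\<And>i j. i \<le> n \<Longrightarrow> j \<le> n \<Longrightarrow> bracket G (e i) (e j) = (\<Sum>k=0..n. C i j k *\<^sub>R e k)"
    and \<xi>: "\<xi> \<in> lie_dual G" and j: "j \<le> n"
  shows "\<xi> (bracket G (control \<xi>) (e j)) = (\<Sum>k=0..n. C 0 j k * \<xi> (e 0) * \<xi> (e k)
            - (\<Sum>i=1..r. C i j k * \<xi> (e i) * \<xi> (e k)))"
proof -
  have linear: "bracket G (control \<xi>) (e j) = (\<Sum>i=0..r. (sig i * \<xi> (e i)) *\<^sub>R bracket G (e i) (e j))"
    unfolding control_def
    using j r_le_n frame_in_lie_algebra
    by (intro linear_on_subspace_sum[OF subspace_lie_algebra] bracket_add_left bracket_scaleR_left) simp_all
  have "\<xi> (bracket G (control \<xi>) (e j)) = (\<Sum>i=0..r. (sig i * \<xi> (e i)) * \<xi> (bracket G (e i) (e j)))"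
    unfolding linear using j r_le_n C by (intro covector_sum \<xi>) (simp add: frame_sum_in_lie_algebra)
  also have "\<dots> = (\<Sum>i=0..r. (sig i * \<xi> (e i)) * (\<Sum>k=0..n. C i j k * \<xi> (e k)))"
  proof (intro sum.cong refl)
    fix i assume "i \<in> {0..r}"
    then have "i \<le> n" using r_le_n by simp
    have "\<xi> (bracket G (e i) (e j)) = (\<Sum>k=0..n. C i j k * \<xi> (e k))"
      unfolding C[OF \<open>i \<le> n\<close> j] using frame_in_lie_algebra by (intro covector_sum \<xi>) simp
    then show "sig i * \<xi> (e i) * \<xi> (bracket G (e i) (e j))
        = sig i * \<xi> (e i) * (\<Sum>k=0..n. C i j k * \<xi> (e k))" by simp
  qed
  also have "\<dots> = (\<Sum>k=0..n. \<Sum>i=0..r. sig i * \<xi> (e i) * C i j k * \<xi> (e k))"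
    by (subst sum.swap) (simp add: sum_distrib_left mult.assoc)
  also have "\<dots> = (\<Sum>k=0..n. C 0 j k * \<xi> (e 0) * \<xi> (e k)
            - (\<Sum>i=1..r. C i j k * \<xi> (e i) * \<xi> (e k)))"
  proof (intro sum.cong refl)
    fix k
    have "(\<Sum>i=1..r. sig i * \<xi> (e i) * C i j k * \<xi> (e k)) = (\<Sum>i=1..r. - (C i j k * \<xi> (e i) * \<xi> (e k)))"
      by (intro sum.cong) (auto simp: sig_def)
    then show "(\<Sum>i=0..r. sig i * \<xi> (e i) * C i j k * \<xi> (e k)) = C 0 j k * \<xi> (e 0) * \<xi> (e k)
            - (\<Sum>i=1..r. C i j k * \<xi> (e i) * \<xi> (e k))"
      by (simp add: sum.atLeast_Suc_atMost sig_def sum_negf)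
  qed
  finally show ?thesis .
qed

section \<open>The differential equations of extremals\<close>

lemma control_apply: "control \<xi> p f = (\<Sum>i=0..r. sig i * \<xi> (e i) * e i p f)"
proof -
  have "control \<xi> p f = (\<Sum>i=0..r. (sig i * \<xi> (e i)) *\<^sub>R e i p f)"
    unfolding control_def
    by (rule linear_on_subspace_sum[OF subspace_UNIV, where F = "\<lambda>X. X p f"]) simp_all
  then show ?thesis by simp
qed

text \<open>The minimum condition determines the control almost everywhere as a function of the covector.
  Substituting it makes the right-hand sides of the adjoint equation and of the velocity equation
  continuous in time, and both equations then hold at every time.\<close>

lemma extremal_equations:
  assumes C: "\<And>i j. i \<le> n \<Longrightarrow> j \<le> n \<Longrightarrow> bracket G (e i) (e j) = (\<Sum>k=0..n. C i j k *\<^sub>R e k)"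
    and extremal: "normal_isotropic_extremal_with G \<pp> B (e 0) g \<psi>"
  shows "has_velocity G g (dl G (g t) (control (\<psi> t))) t" (is ?velocity)
    and "B (control (\<psi> t)) (control (\<psi> t)) = 0" (is ?null)
    and "j \<le> n \<Longrightarrow> ((\<lambda>s. \<psi> s (e j)) has_real_derivative
          (\<Sum>k=0..n. C 0 j k * \<psi> t (e 0) * \<psi> t (e k)
            - (\<Sum>i=1..r. C i j k * \<psi> t (e i) * \<psi> t (e k)))) (at t)" (is "_ \<Longrightarrow> ?adjoint")
proof -
  have dual: "\<psi> t \<in> lie_dual G" for t
    using extremal by (simp add: normal_isotropic_extremal_with_def)
  have ac: "abs_continuous_on {a..b} (\<lambda>t. \<psi> t v)" if "v \<in> lie_algebra G" for a b v
    using extremal that by (simp add: normal_isotropic_extremal_with_def)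
  have one: "\<psi> t (e 0) = 1" for t
    using extremal by (simp add: normal_isotropic_extremal_with_def)
  obtain u where hor: "horizontal_curve G \<pp> g u"
    and adj: "AE t in lebesgue. \<forall>v\<in>lie_algebra G.
        ((\<lambda>s. \<psi> s v) has_real_derivative \<psi> t (bracket G (u t) v)) (at t)"
    and min: "AE t in lebesgue.
        is_arg_min (B (covector_to_vector G B (\<psi> t)))
          (\<lambda>w. w \<in> unit_space_vectors \<pp> B (e 0)) (u t - e 0) \<and>
        B (covector_to_vector G B (\<psi> t)) (u t - e 0) = - 1"
    using extremal unfolding normal_isotropic_extremal_with_def by blast
  have u: "AE t in lebesgue. u t = control (\<psi> t)"
    using min by eventually_elim (use minimizer_eq_control(1)[OF dual one] in blast)
  have sphere_AE: "AE t in lebesgue. (\<Sum>i=1..r. (\<psi> t (e i))\<^sup>2) = 1"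
    using min by eventually_elim (use minimizer_eq_control(2)[OF dual one] in blast)
  have cont: "continuous_on UNIV (\<lambda>t. \<psi> t (e i))" if "i \<le> n" for i
    unfolding continuous_on_eq_continuous_at[OF open_UNIV]
  proof
    fix t
    have "continuous_on {t - 1..t + 1} (\<lambda>t. \<psi> t (e i))"
      by (intro abs_continuous_on_imp_continuous_on ac frame_in_lie_algebra that)
    then show "isCont (\<lambda>t. \<psi> t (e i)) t"
      by (rule continuous_on_interior) (simp add: interior_atLeastAtMost_real)
  qed
  \<comment> \<open>The normalization of the covector is closed under limits in time, so it holds at every time.\<close>
  have "(\<Sum>i=1..r. (\<psi> t (e i))\<^sup>2) = 1"
  proof (rule AE_lebesgue_imp_all_eq[OF _ _ sphere_AE])
    show "continuous_on UNIV (\<lambda>t. \<Sum>i=1..r. (\<psi> t (e i))\<^sup>2)"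
      using r_le_n by (intro continuous_on_sum continuous_on_power cont) simp
  qed (rule continuous_on_const)
  then show ?null by (simp add: control_form one)
  show ?adjoint if j: "j \<le> n"
  proof -
    let ?h = "\<lambda>t. \<Sum>k=0..n. C 0 j k * \<psi> t (e 0) * \<psi> t (e k)
            - (\<Sum>i=1..r. C i j k * \<psi> t (e i) * \<psi> t (e k))"
    have "((\<lambda>s. \<psi> s (e j)) has_vector_derivative ?h t) (at t)"
    proof (rule has_vector_derivative_abs_continuous_AE)
      show "abs_continuous_on {t - 1..t + 1} (\<lambda>s. \<psi> s (e j))"
        using j by (intro ac frame_in_lie_algebra)
      have "continuous_on UNIV ?h"
        using r_le_n by (intro continuous_intros cont) simp_all
      then show "continuous_on {t - 1..t + 1} ?h"
        by (rule continuous_on_subset) simp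
      show "AE t' in lebesgue. t' \<in> {t - 1<..<t + 1} \<longrightarrow>
          ((\<lambda>s. \<psi> s (e j)) has_vector_derivative ?h t') (at t')"
        using adj u
      proof eventually_elim
        case (elim t')
        have "\<psi> t' (bracket G (control (\<psi> t')) (e j)) = ?h t'"
          by (rule bracket_control[OF C dual j])
        then have "((\<lambda>s. \<psi> s (e j)) has_real_derivative ?h t') (at t')"
          using elim frame_in_lie_algebra[OF j] by metis
        then show ?case
          unfolding has_real_derivative_iff_has_vector_derivative by (rule impI)
      qed
    qed simp
    then show ?thesis by (simp only: has_real_derivative_iff_has_vector_derivative)
  qed
  have manifold: "smooth_manifold (atlas G)"
    using lie_group by (simp add: lie_group_def)
  have curve: "lipschitz_curve G g"
    using hor by (simp add: horizontal_curve_def)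
  have vel: "AE t in lebesgue. has_velocity G g (dl G (g t) (u t)) t"
    using hor by (simp add: horizontal_curve_def)
  have dl: "dl G (g t) (control (\<psi> t)) = control (\<psi> t) (g t)" for t
    by (rule dl_eq[OF lie_group control_in_lie_algebra])
  show ?velocity
    unfolding has_velocity_def dl
  proof (intro conjI ballI)
    show "control (\<psi> t) (g t) \<in> tangent_space G (g t)"
      by (rule lie_algebra_tangent[OF control_in_lie_algebra])
    fix f assume f: "f \<in> smooth_funs G"
    show "((\<lambda>s. f (g s)) has_real_derivative control (\<psi> t) (g t) f) (at t)"
    proof (rule has_real_derivative_smooth_fun_along_lipschitz_curve[OF manifold curve f,
          of "\<lambda>t. control (\<psi> t) (g t) f"])
      have "continuous_on UNIV (\<lambda>t. e i (g t) f)" if "i \<le> n" for i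
        by (rule continuous_smooth_fun_along_lipschitz_curve[OF manifold curve
              lie_algebra_smooth[OF frame_in_lie_algebra[OF that] f]])
      then show "continuous_on UNIV (\<lambda>t. control (\<psi> t) (g t) f)"
        unfolding control_apply using r_le_n by (intro continuous_on_sum continuous_on_mult continuous_on_const cont) simp_all
      show "AE t in lebesgue. ((\<lambda>s. f (g s)) has_real_derivative control (\<psi> t) (g t) f) (at t)"
        using vel u
      proof eventually_elim
        case (elim t)
        then have "has_velocity G g (control (\<psi> t) (g t)) t" by (simp add: dl)
        then show ?case using f unfolding has_velocity_def by blast
      qed
    qed
  qed
qed

end

theorem theorem3:
  fixes G :: "('a::{t2_space, second_countable_topology}, 'e::euclidean_space) smooth_group"
    and \<pp> :: "'a vfield set"
    and B :: "'a vfield \<Rightarrow> 'a vfield \<Rightarrow> real"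
    and n r :: nat
    and e :: "nat \<Rightarrow> 'a vfield"
    and C :: "nat \<Rightarrow> nat \<Rightarrow> nat \<Rightarrow> real"
    and g :: "real \<Rightarrow> 'a"
  assumes "sub_lorentzian G \<pp> B n r e"
    and "\<And>i j. i \<le> n \<Longrightarrow> j \<le> n \<Longrightarrow> bracket G (e i) (e j) = (\<Sum>k=0..n. C i j k *\<^sub>R e k)"
    and "normal_isotropic_extremal G \<pp> B (e 0) g"
  shows "(\<exists>\<psi>. normal_isotropic_extremal_with G \<pp> B (e 0) g \<psi>) \<and>
    (\<forall>\<psi>. normal_isotropic_extremal_with G \<pp> B (e 0) g \<psi> \<longrightarrow>
      (\<exists>u. (\<forall>t. has_velocity G g (dl G (g t) (u t)) t) \<and>
        (\<forall>t. u t = \<psi> t (e 0) *\<^sub>R e 0 - (\<Sum>i=1..r. \<psi> t (e i) *\<^sub>R e i)) \<and>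
        pseudo_norm B (u 0) = 0 \<and>
        (\<forall>t. \<psi> t (e 0) = 1) \<and>
        (\<forall>j\<in>{1..n}. \<forall>t. ((\<lambda>s. \<psi> s (e j)) has_real_derivative
          (\<Sum>k=0..n. C 0 j k * \<psi> t (e 0) * \<psi> t (e k)
            - (\<Sum>i=1..r. C i j k * \<psi> t (e i) * \<psi> t (e k)))) (at t))))"
proof (intro conjI allI impI)
  show "\<exists>\<psi>. normal_isotropic_extremal_with G \<pp> B (e 0) g \<psi>"
    using assms(3) by (simp add: normal_isotropic_extremal_def)
next
  interpret orthonormal_frame G \<pp> B n r e
    by unfold_locales (rule assms(1))
  fix \<psi> assume \<psi>: "normal_isotropic_extremal_with G \<pp> B (e 0) g \<psi>"
  note equations = extremal_equations[OF assms(2) \<psi>]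
  show "\<exists>u. (\<forall>t. has_velocity G g (dl G (g t) (u t)) t) \<and>
        (\<forall>t. u t = \<psi> t (e 0) *\<^sub>R e 0 - (\<Sum>i=1..r. \<psi> t (e i) *\<^sub>R e i)) \<and>
        pseudo_norm B (u 0) = 0 \<and>
        (\<forall>t. \<psi> t (e 0) = 1) \<and>
        (\<forall>j\<in>{1..n}. \<forall>t. ((\<lambda>s. \<psi> s (e j)) has_real_derivative
          (\<Sum>k=0..n. C 0 j k * \<psi> t (e 0) * \<psi> t (e k)
            - (\<Sum>i=1..r. C i j k * \<psi> t (e i) * \<psi> t (e k)))) (at t))"
  proof (intro exI[of _ "\<lambda>t. control (\<psi> t)"] conjI allI ballI)
    show "pseudo_norm B (control (\<psi> 0)) = 0"
      by (simp add: pseudo_norm_def equations(2))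
    show "\<psi> t (e 0) = 1" for t
      using \<psi> by (simp add: normal_isotropic_extremal_with_def)
  qed (rule equations(1) control_eq equations(3); simp)+
qed

end
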